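(* Let $-1\le B<A\le 1$, let $f\in\mathcal{S}^*(A,B)$, let $\lambda>0$, and write $$\left(\frac{f(z)}{z}\right)^{-\lambda}=1+\sum_{n=1}^{\infty}a_n(-\lambda,f)z^n,\qquad |z|<1 .$$ Put $\delta=(1-A)/(1-B)$, so that $0\le\delta<1$. Then: (i) If $0<\lambda\le 1$ (and $0\le\delta<1$), then $$|a_l(-\lambda,f)|\le\frac{\lambda(A-B)}{l},\qquad l=1,2,\ldots \tag{a}$$ (ii) If $\lambda>1$, $\delta\in\mathbb{I}_k(\lambda)$ for some $k\in\{0,1,\ldots,[\lambda]-1\}$, and $\lambda(1-\delta)\notin\mathbb{N}$, then $$|a_l(-\lambda,f)|\le\prod_{j=0}^{l-1}\frac{\lambda(A-B)+Bj}{j+1},\qquad l=1,2,\ldots,[\lambda]-k, \tag{b}$$ and $$|a_l(-\lambda,f)|\le\left(\frac{[\lambda]-k}{l}\right)\prod_{j=0}^{[\lambda]-k-1}\frac{\lambda(A-B)+Bj}{j+1},\qquad l=[\lambda]-k+1,\ [\lambda]-k+2,\ldots; \tag{c}$$ while if $\lambda>1$, $\delta\in\mathbb{I}_k(\lambda)$ and $\lambda(1-\delta)\in\mathbb{N}$, then the inequality in (b) holds for $l=1,2,\ldots,[\lambda]-k+1$ and the inequality in (c) holds for $l=[\lambda]-k+2,[\lambda]-k+3,\ldots$. In particular, if $\lambda>1$ and $\delta\in\mathbb{I}_{[\lambda]-1}(\lambda)$, then $$|a_l(-\lambda,f)|\le\frac{\lambda(A-B)}{l},\qquad l=1,2,\ldots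 \tag{d}$$ (iii) If $\lambda>1$ and $\delta\in\mathbb{J}(\lambda)$, then $$|a_l(-\lambda,f)|\le\prod_{j=0}^{l-1}\frac{\lambda(A-B)+Bj}{j+1},\qquad l=1,2,\ldots,[\lambda]+1, \tag{e}$$ and $$|a_l(-\lambda,f)|\le\left(\frac{[\lambda]+1}{l}\right)\prod_{j=0}^{[\lambda]}\frac{\lambda(A-B)+Bj}{j+1},\qquad l=[\lambda]+2,[\lambda]+3,\ldots$$ The estimates (a), (b), (d) and (e) are sharp.
   Context: For $-1\le B<A\le1$, $\mathcal{S}^*(A,B)$ is the class of analytic functions $f(z)=z+\sum_{n=2}^\infty a_nz^n$ in the unit disk $\mathbb{D}=\{|z|<1\}$ satisfying $\frac{zf'(z)}{f(z)}\prec\frac{1+Az}{1+Bz}$ in $\mathbb{D}$, where $\prec$ denotes subordination of analytic functions in $\mathbb{D}$. Such $f$ are univalent, so $f(z)/z$ is zero-free in $\mathbb{D}$, and $(f(z)/z)^{-\lambda}$ denotes the analytic branch with value $1$ at $z=0$. $[\lambda]$ denotes the greatest integer $\le\lambda$. For $\lambda>1$, $$\mathbb{J}(\lambda)=\left\{\delta\in\mathbb{R}:0\le\delta<\frac{\lambda-[\lambda]}{\lambda}\right\},$$ $$\mathbb{I}_k(\lambda)=\left\{\delta\in\mathbb{R}:\frac{\lambda-[\lambda]+k}{\lambda}\le\delta<\frac{\lambda-[\lambda]+k+1}{\lambda}\right\},\quad k=0,1,\ldots,[\lambda]-1$$ ($\mathbb{J}(\lambda)=\emptyset$ if $\lambda$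 is an integer). An estimate is called sharp if, for each admissible choice of the parameters and of the index $l$, equality is attained by some function in $\mathcal{S}^*(A,B)$. *)

theory Defs
  imports "HOL-Complex_Analysis.Complex_Analysis"
begin

text \<open>Subordination of analytic functions in the unit disk \<^term>\<open>ball 0 1 :: complex set\<close>.\<close>

definition subordinate :: "(complex \<Rightarrow> complex) \<Rightarrow> (complex \<Rightarrow> complex) \<Rightarrow> bool"
    (infix "\<prec>\<^sub>D" 50) where
  "F \<prec>\<^sub>D G \<longleftrightarrow> F holomorphic_on ball 0 1 \<and> G holomorphic_on ball 0 1 \<and>
     (\<exists>w. w holomorphic_on ball 0 1 \<and> w 0 = 0 \<and>
          (\<forall>z\<in>ball 0 1. norm (w z) < 1 \<and> F z = G (w z)))"

text \<open>
  The quotients \<open>z f'(z) / f(z)\<close> and \<open>f(z) / z\<close> have a removable singularity at the origin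
  when \<open>f 0 = 0\<close> and \<open>f' 0 \<noteq> 0\<close>; the value there is filled in.
  For \<open>z \<noteq> 0\<close> with \<open>f z = 0\<close>, Isabelle's \<open>x / 0 = 0\<close> does not enlarge the class
  \<open>janowski_starlike\<close> below: such a \<open>z\<close> is a pole of the true quotient, so the filled-in
  function is not holomorphic and the subordination fails.
\<close>

definition starlike_quotient :: "(complex \<Rightarrow> complex) \<Rightarrow> complex \<Rightarrow> complex" where
  "starlike_quotient f z = (if z = 0 then 1 else z * deriv f z / f z)"

definition quotient_by_id :: "(complex \<Rightarrow> complex) \<Rightarrow> complex \<Rightarrow> complex" where
  "quotient_by_id f z = (if z = 0 then deriv f 0 else f z / z)"

text \<open>The class \<open>S\<^sup>*(A,B)\<close>.\<close>

definition janowski_starlike :: "real \<Rightarrow> real \<Rightarrow> (complex \<Rightarrow> complex) set" where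
  "janowski_starlike A B =
     {f. f holomorphic_on ball 0 1 \<and> f 0 = 0 \<and> deriv f 0 = 1 \<and>
         starlike_quotient f \<prec>\<^sub>D
           (\<lambda>z. (1 + complex_of_real A * z) / (1 + complex_of_real B * z))}"

text \<open>
  The analytic branch of \<open>h\<^sup>\<mu>\<close> in the disk with value 1 at the origin, for zero-free analytic
  \<open>h\<close> with \<open>h 0 = 1\<close>. The logarithm chosen here then exists and is unique on the disk; its
  values outside the disk are irrelevant.
\<close>

definition log_branch :: "(complex \<Rightarrow> complex) \<Rightarrow> complex \<Rightarrow> complex" where
  "log_branch h = (SOME L. L holomorphic_on ball 0 1 \<and> L 0 = 0 \<and>
                           (\<forall>z\<in>ball 0 1. exp (L z) = h z))"

definition power_branch :: "(complex \<Rightarrow> complex) \<Rightarrow> real \<Rightarrow> complex \<Rightarrow> complex" where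
  "power_branch h \<mu> z = exp (complex_of_real \<mu> * log_branch h z)"

text \<open>The Taylor coefficient \<open>a\<^sub>n(\<mu>,f)\<close> at the origin of \<open>(f(z)/z)\<^sup>\<mu>\<close>.\<close>

definition power_coeff :: "real \<Rightarrow> (complex \<Rightarrow> complex) \<Rightarrow> nat \<Rightarrow> complex" where
  "power_coeff \<mu> f n = fps_nth (fps_expansion (power_branch (quotient_by_id f) \<mu>) 0) n"

definition J_set :: "real \<Rightarrow> real set" where
  "J_set lam = {\<delta>. 0 \<le> \<delta> \<and> \<delta> < (lam - real_of_int \<lfloor>lam\<rfloor>) / lam}"

definition I_set :: "nat \<Rightarrow> real \<Rightarrow> real set" where
  "I_set k lam = {\<delta>. (lam - real_of_int \<lfloor>lam\<rfloor> + real k) / lam \<le> \<delta> \<and>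
                   \<delta> < (lam - real_of_int \<lfloor>lam\<rfloor> + real k + 1) / lam}"

definition coeff_prod :: "real \<Rightarrow> real \<Rightarrow> real \<Rightarrow> nat \<Rightarrow> real" where
  "coeff_prod A B lam l = (\<Prod>j<l. (lam * (A - B) + B * real j) / (real j + 1))"

text \<open>
  \<open>coeff_estimate A B lam l M\<close> is the estimate \<open>\<bar>a\<^sub>l(-lam,f)\<bar> \<le> M\<close> for the whole class;
  it is sharp if equality is attained in the class.
\<close>

definition coeff_estimate :: "real \<Rightarrow> real \<Rightarrow> real \<Rightarrow> nat \<Rightarrow> real \<Rightarrow> bool" where
  "coeff_estimate A B lam l M \<longleftrightarrow>
     (\<forall>f\<in>janowski_starlike A B. norm (power_coeff (-lam) f l) \<le> M)"

definition sharp_coeff_estimate :: "real \<Rightarrow> real \<Rightarrow> real \<Rightarrow> nat \<Rightarrow> real \<Rightarrow> bool" where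
  "sharp_coeff_estimate A B lam l M \<longleftrightarrow>
     coeff_estimate A B lam l M \<and>
     (\<exists>f\<in>janowski_starlike A B. norm (power_coeff (-lam) f l) = M)"

end

theory Submission
  imports Defs
begin

text \<open>
  Write \<open>c = lam (A - B)\<close> and let \<open>g = \<Sum> a\<^sub>n z\<^sup>n\<close> be the branch of \<open>(f(z)/z)\<close> to the power \<open>-lam\<close>.
  If \<open>w\<close> is the Schwarz function of the subordination, logarithmic differentiation of \<open>g\<close> turns
  \<open>z f' / f = (1 + A w) / (1 + B w)\<close> into the linear equation
  \<open>z g' = - w (c g + B z g')\<close> (lemma \<open>power_branch_differential_equation\<close>). The \<open>n\<close>-th
  coefficients of \<open>z g'\<close> and of \<open>c g + B z g'\<close> are \<open>n a\<^sub>n\<close> and \<open>(c + B n) a\<^sub>n\<close>.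
  Multiplication by \<open>w\<close> raises the order of a power series and does not increase moduli, so
  Clunie's method (lemma \<open>clunie_inequality\<close>) gives, for every \<open>l\<close>,
  \<open>l\<^sup>2 |a\<^sub>l|\<^sup>2 \<le> (\<Sum>n<l. ((c + B n)\<^sup>2 - n\<^sup>2) |a\<^sub>n|\<^sup>2)\<close>.

  Everything else is governed by the sign of the weight
  \<open>(c + B n)\<^sup>2 - n\<^sup>2 = (c - n (1 - B)) (c + n (1 + B))\<close>, which changes at
  \<open>t = c / (1 - B) = lam (1 - \<delta>)\<close>. As long as all \<open>n < l\<close> satisfy \<open>n \<le> t\<close>, the weights are
  nonnegative and induction yields the product bound, because the right-hand side telescopes
  when \<open>|a\<^sub>n|\<close> is replaced by the product. The terms with \<open>n \<ge> t\<close> are nonpositive; dropping them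
  freezes the right-hand side, and dividing by \<open>l\<^sup>2\<close> produces the bounds that decay like
  \<open>1 / l\<close> (lemma \<open>coefficient_recursion_bounds\<close>). The conditions \<open>\<delta> \<in> I_set k lam\<close> and
  \<open>\<delta> \<in> J_set lam\<close> say between which two consecutive integers \<open>t\<close> lies. At an integer \<open>t\<close> the
  weight of \<open>n = t\<close> vanishes, so that term may be counted on either side; this is why the
  product bound then reaches one index further.

  The products are attained by \<open>w(z) = z\<close>, and \<open>c / l\<close> by \<open>w(z) = z\<^sup>l\<close>
  (lemma \<open>extremal_function\<close>).
\<close>

section \<open>Coefficients of dominated power series\<close>

lemma taylor_remainder:
  assumes "g holomorphic_on ball 0 1"
  obtains R where "R holomorphic_on ball 0 1"
    and "\<And>z. norm z < 1 \<Longrightarrow>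
           g z = (\<Sum>n<l. fps_nth (fps_expansion g 0) n * z ^ n) + z ^ l * R z"
proof -
  define a where "a = fps_nth (fps_expansion g 0)"
  define R where "R z = (if z = 0 then a l else (g z - (\<Sum>n<l. a n * z ^ n)) / z ^ l)" for z
  have g_sums: "(\<lambda>n. a n * z ^ n) sums g z" if "norm z < 1" for z
    using holomorphic_power_series[OF assms, of z] that by (simp add: a_def fps_expansion_def)
  have "(\<lambda>n. a (n + l) * (z - 0) ^ n) sums R z" if "z \<in> ball 0 1" for z
  proof (cases "z = 0")
    case True
    then show ?thesis
      using powser_sums_zero[of "\<lambda>n. a (n + l)"] by (simp add: R_def)
  next
    case False
    have "(\<lambda>n. a (n + l) * z ^ (n + l)) sums (g z - (\<Sum>n<l. a n * z ^ n))"
      using sums_split_initial_segment[OF g_sums[of z], of l] that by simp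
    from sums_divide[OF this, of "z ^ l"] False show ?thesis
      by (simp add: R_def power_add)
  qed
  then have "R holomorphic_on ball 0 1"
    by (rule power_series_holomorphic)
  moreover have "g z = (\<Sum>n<l. a n * z ^ n) + z ^ l * R z" if "norm z < 1" for z
  proof (cases "z = 0")
    case True
    have "g 0 = a 0"
      using sums_unique2[OF g_sums[of 0] powser_sums_zero[of a]] by simp
    then show ?thesis
      using True by (cases l) (simp_all add: R_def sum.lessThan_Suc_shift)
  qed (simp add: R_def)
  ultimately show thesis
    using that unfolding a_def by blast
qed

text \<open>
  On \<open>|z| = r\<close> one has \<open>cnj z = r\<^sup>2 / z\<close> (for \<open>z \<noteq> 0\<close>), so the conjugate of a polynomial of
  degree below \<open>k\<close>, multiplied by \<open>z\<^sup>k\<close>, agrees with a polynomial vanishing at the origin. Cross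
  terms in squared moduli thus become real parts of holomorphic functions, to which the maximum
  principle applies. This replaces the orthogonality of the powers of \<open>z\<close> in \<open>L\<^sup>2\<close> of the circle.
\<close>

lemma cross_term_on_circle:
  assumes "T holomorphic_on ball 0 1"
  obtains H where "H holomorphic_on ball 0 1" and "H 0 = 0"
    and "\<And>z. norm z = r \<Longrightarrow> cnj (\<Sum>n<k. p n * z ^ n) * (z ^ k * T z) = H z"
proof
  let ?H = "\<lambda>z. (\<Sum>n<k. cnj (p n) * of_real (r ^ (2 * n)) * z ^ (k - n)) * T z"
  show "?H holomorphic_on ball 0 1"
    by (intro holomorphic_intros assms)
  show "?H 0 = 0"
    by (simp add: power_0_left)
  fix z :: complex assume z: "norm z = r"
  have "cnj (z ^ n) * z ^ k = of_real (r ^ (2 * n)) * z ^ (k - n)" if "n < k" for n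
  proof -
    have "cnj (z ^ n) * z ^ k = (z * cnj z) ^ n * z ^ (k - n)"
      using that by (simp add: power_mult_distrib mult_ac flip: power_add)
    also have "z * cnj z = of_real (r ^ 2)"
      using z complex_norm_square[of z] by simp
    finally show ?thesis
      by (simp add: power_mult)
  qed
  then have "(\<Sum>n<k. cnj (p n) * (cnj (z ^ n) * z ^ k)) * T z = ?H z"
    by (simp add: mult.assoc)
  moreover have "cnj (\<Sum>n<k. p n * z ^ n) * (z ^ k * T z) =
      (\<Sum>n<k. cnj (p n) * (cnj (z ^ n) * z ^ k)) * T z"
    by (simp add: sum_distrib_right mult.assoc)
  ultimately show "cnj (\<Sum>n<k. p n * z ^ n) * (z ^ k * T z) = ?H z"
    by (simp only:)
qed

lemma norm_add_squared:
  "(norm (u + v))\<^sup>2 = (norm u)\<^sup>2 + (norm v)\<^sup>2 + 2 * Re (cnj u * v)" for u v :: complex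
  unfolding cmod_power2 by (simp add: power2_eq_square algebra_simps)

text \<open>
  Parseval's identity without integration: the deviation of the squared modulus from its mean
  is the real part of a holomorphic function vanishing at the origin.
\<close>

lemma norm_polynomial_on_circle:
  obtains \<Phi> where "\<Phi> holomorphic_on ball 0 1" and "\<Phi> 0 = 0"
    and "\<And>z. norm z = r \<Longrightarrow>
           (norm (\<Sum>n<k. p n * z ^ n))\<^sup>2 = (\<Sum>n<k. (norm (p n))\<^sup>2 * r ^ (2 * n)) + Re (\<Phi> z)"
proof (induction k arbitrary: thesis)
  case 0
  show ?case
    by (rule 0[of "\<lambda>_. 0"]) auto
next
  case (Suc k)
  obtain \<Phi> where \<Phi>: "\<Phi> holomorphic_on ball 0 1" "\<Phi> 0 = 0"
    "\<And>z. norm z = r \<Longrightarrow>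
       (norm (\<Sum>n<k. p n * z ^ n))\<^sup>2 = (\<Sum>n<k. (norm (p n))\<^sup>2 * r ^ (2 * n)) + Re (\<Phi> z)"
    using Suc.IH by blast
  obtain H where H: "H holomorphic_on ball 0 1" "H 0 = 0"
    "\<And>z. norm z = r \<Longrightarrow> cnj (\<Sum>n<k. p n * z ^ n) * (z ^ k * p k) = H z"
    by (rule cross_term_on_circle[of "\<lambda>_. p k" r p k]) auto
  show ?case
  proof (rule Suc.prems[of "\<lambda>z. \<Phi> z + 2 * H z"])
    show "(\<lambda>z. \<Phi> z + 2 * H z) holomorphic_on ball 0 1"
      by (intro holomorphic_intros \<Phi> H)
    fix z :: complex assume z: "norm z = r"
    have "(norm (p k * z ^ k))\<^sup>2 = (norm (p k))\<^sup>2 * r ^ (2 * k)"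
      using z by (simp add: norm_mult norm_power power_mult_distrib power_even_eq)
    then show "(norm (\<Sum>n<Suc k. p n * z ^ n))\<^sup>2 =
        (\<Sum>n<Suc k. (norm (p n))\<^sup>2 * r ^ (2 * n)) + Re (\<Phi> z + 2 * H z)"
      using \<Phi>(3)[OF z] H(3)[OF z]
      by (simp add: norm_add_squared mult.commute[of "z ^ k" "p k"])
  qed (simp add: \<Phi> H)
qed

text \<open>
  On a circle of radius \<open>r < 1\<close> the squared moduli of the two polynomials differ from their
  weighted coefficient sums by real parts of holomorphic functions vanishing at the origin. If
  the sum for \<open>q\<close> were larger, domination would make the real part of one such function bounded
  by a negative constant on the whole circle, against its value \<open>0\<close> at the centre. Letting \<open>r\<close>
  tend to \<open>1\<close> removes the weights. The tail \<open>z\<^sup>k T\<close> only adds to the mean square of the left-hand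
  side, which is why it may be arbitrary.
\<close>

lemma coefficient_sums_le_of_dominated:
  fixes p q :: "nat \<Rightarrow> complex"
  assumes T: "T holomorphic_on ball 0 1"
    and dom: "\<And>z. norm z < 1 \<Longrightarrow>
           norm ((\<Sum>n<k. q n * z ^ n) + z ^ k * T z) \<le> norm (\<Sum>n<m. p n * z ^ n)"
  shows "(\<Sum>n<k. (norm (q n))\<^sup>2) \<le> (\<Sum>n<m. (norm (p n))\<^sup>2)"
proof -
  have radius: "(\<Sum>n<k. (norm (q n))\<^sup>2 * r ^ (2 * n)) \<le> (\<Sum>n<m. (norm (p n))\<^sup>2 * r ^ (2 * n))"
    (is "?Q \<le> ?P") if r: "0 < r" "r < 1" for r :: real
  proof -
    obtain \<Psi> where \<Psi>: "\<Psi> holomorphic_on ball 0 1" "\<Psi> 0 = 0"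
      "\<And>z. norm z = r \<Longrightarrow> (norm (\<Sum>n<k. q n * z ^ n))\<^sup>2 = ?Q + Re (\<Psi> z)"
      using norm_polynomial_on_circle[of r q k] by blast
    obtain \<Phi> where \<Phi>: "\<Phi> holomorphic_on ball 0 1" "\<Phi> 0 = 0"
      "\<And>z. norm z = r \<Longrightarrow> (norm (\<Sum>n<m. p n * z ^ n))\<^sup>2 = ?P + Re (\<Phi> z)"
      using norm_polynomial_on_circle[of r p m] by blast
    obtain H where H: "H holomorphic_on ball 0 1" "H 0 = 0"
      "\<And>z. norm z = r \<Longrightarrow> cnj (\<Sum>n<k. q n * z ^ n) * (z ^ k * T z) = H z"
      using cross_term_on_circle[OF T, of r q k] by blast
    define D where "D z = \<Psi> z + 2 * H z - \<Phi> z" for z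
    have D: "D holomorphic_on ball 0 1"
      unfolding D_def by (intro holomorphic_intros \<Psi> \<Phi> H)
    have "Re (D 0) \<le> ?P - ?Q"
    proof (rule maximum_real_frontier[of D "cball 0 r"])
      show "D holomorphic_on interior (cball 0 r)"
        using r by (intro holomorphic_on_subset[OF D]) auto
      show "continuous_on (closure (cball 0 r)) D"
        using r by (intro holomorphic_on_imp_continuous_on holomorphic_on_subset[OF D]) auto
      fix z :: complex assume "z \<in> frontier (cball 0 r)"
      then have z: "norm z = r"
        using r by (simp add: frontier_cball)
      have "?Q + Re (\<Psi> z) + 2 * Re (H z) \<le>
          (norm ((\<Sum>n<k. q n * z ^ n) + z ^ k * T z))\<^sup>2"
        using \<Psi>(3)[OF z] H(3)[OF z] by (simp add: norm_add_squared)
      also have "\<dots> \<le> (norm (\<Sum>n<m. p n * z ^ n))\<^sup>2"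
        using dom[of z] z r by (intro power_mono) auto
      also have "\<dots> = ?P + Re (\<Phi> z)"
        using \<Phi>(3)[OF z] .
      finally show "Re (D z) \<le> ?P - ?Q"
        by (simp add: D_def)
    qed (use r in auto)
    then show ?thesis
      by (simp add: D_def \<Psi> \<Phi> H)
  qed
  have lim: "((\<lambda>r. \<Sum>n<j. (norm (s n))\<^sup>2 * r ^ (2 * n)) \<longlongrightarrow> (\<Sum>n<j. (norm (s n))\<^sup>2)) (at_left 1)"
    for s :: "nat \<Rightarrow> complex" and j
    by (rule tendsto_eq_intros refl)+ simp
  have "eventually (\<lambda>r::real. r \<in> {0<..<1}) (at_left 1)"
    by (rule eventually_at_left_real) simp
  then have "eventually (\<lambda>r. (\<Sum>n<k. (norm (q n))\<^sup>2 * r ^ (2 * n))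
      \<le> (\<Sum>n<m. (norm (p n))\<^sup>2 * r ^ (2 * n))) (at_left 1)"
    by eventually_elim (use radius in auto)
  then show ?thesis
    by (rule tendsto_le[OF trivial_limit_at_left_real lim lim])
qed

text \<open>
  Since \<open>w\<close> vanishes at the origin, the terms of degree at least \<open>l\<close> in \<open>c g + B z g'\<close>
  contribute only from degree \<open>l + 1\<close> on to \<open>z g'\<close>. Moved to the left-hand side, they leave a
  series with initial coefficients \<open>n a\<^sub>n\<close>, \<open>n \<le> l\<close>, that equals \<open>-w\<close> times the
  polynomial \<open>\<Sum>n<l. (c + B n) a\<^sub>n z\<^sup>n\<close> and is therefore dominated by it.
\<close>

lemma clunie_inequality:
  fixes c B :: real and g :: "complex \<Rightarrow> complex"
  defines "a \<equiv> fps_nth (fps_expansion g 0)"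
  assumes g: "g holomorphic_on ball 0 1"
    and w: "w holomorphic_on ball 0 1" "w 0 = 0" "\<And>z. norm z < 1 \<Longrightarrow> norm (w z) < 1"
    and ode: "\<And>z. norm z < 1 \<Longrightarrow>
           z * deriv g z = - w z * (of_real c * g z + of_real B * (z * deriv g z))"
  shows "(\<Sum>n\<le>l. (real n * norm (a n))\<^sup>2) \<le> (\<Sum>n<l. ((c + B * real n) * norm (a n))\<^sup>2)"
proof -
  obtain R where R: "R holomorphic_on ball 0 1"
    and gR: "\<And>z. norm z < 1 \<Longrightarrow> g z = (\<Sum>n<Suc l. a n * z ^ n) + z ^ Suc l * R z"
    using taylor_remainder[OF g, of "Suc l"] unfolding a_def by blast
  obtain v where v: "v holomorphic_on ball 0 1" "\<And>z. norm z < 1 \<Longrightarrow> w z = z * v z"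
    using Schwarz3[OF w(1,2)] by blast
  define R1 where "R1 z = of_nat (Suc l) * R z + z * deriv R z" for z
  have zg': "z * deriv g z = (\<Sum>n<Suc l. of_nat n * a n * z ^ n) + z ^ Suc l * R1 z"
    if z: "norm z < 1" for z
  proof -
    have R': "(R has_field_derivative deriv R z) (at z)"
      using holomorphic_derivI[OF R open_ball] z by simp
    have "((\<lambda>z. (\<Sum>n<Suc l. a n * z ^ n) + z ^ Suc l * R z) has_field_derivative
        (\<Sum>n<Suc l. a n * (of_nat n * z ^ (n - 1))) +
          (of_nat (Suc l) * z ^ l * R z + z ^ Suc l * deriv R z)) (at z)"
      by (rule derivative_eq_intros R' refl)+ (simp add: mult_ac)
    then have "(g has_field_derivative
        (\<Sum>n<Suc l. a n * (of_nat n * z ^ (n - 1))) +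
          (of_nat (Suc l) * z ^ l * R z + z ^ Suc l * deriv R z)) (at z)"
      by (rule has_field_derivative_transform_within_open[of _ _ _ "ball 0 1"])
         (use z gR in auto)
    then have "z * deriv g z = z * (\<Sum>n<Suc l. a n * (of_nat n * z ^ (n - 1))) +
        z * (of_nat (Suc l) * z ^ l * R z + z ^ Suc l * deriv R z)"
      by (simp add: DERIV_imp_deriv distrib_left del: sum.lessThan_Suc)
    also have "z * (\<Sum>n<Suc l. a n * (of_nat n * z ^ (n - 1))) =
        (\<Sum>n<Suc l. of_nat n * a n * z ^ n)"
      unfolding sum_distrib_left
    proof (intro sum.cong refl)
      show "z * (a n * (of_nat n * z ^ (n - 1))) = of_nat n * a n * z ^ n" for n
        by (cases n) auto
    qed
    finally show ?thesis
      by (simp add: R1_def algebra_simps)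
  qed
  define s where "s n = of_real (c + B * real n) * a n" for n
  define R2 where "R2 z = of_real c * R z + of_real B * R1 z" for z
  define T where "T z = R1 z + v z * (s l + z * R2 z)" for z
  have "(\<Sum>n<Suc l. (norm (of_nat n * a n))\<^sup>2) \<le> (\<Sum>n<l. (norm (s n))\<^sup>2)"
  proof (rule coefficient_sums_le_of_dominated)
    show "T holomorphic_on ball 0 1"
      unfolding T_def R2_def R1_def by (intro holomorphic_intros R v open_ball)
    fix z :: complex assume z: "norm z < 1"
    have "of_real c * g z + of_real B * (z * deriv g z) =
        (\<Sum>n<Suc l. s n * z ^ n) + z ^ Suc l * R2 z"
      unfolding zg'[OF z] gR[OF z]
      by (simp add: s_def R2_def sum_distrib_left sum.distrib algebra_simps)
    also have "\<dots> = (\<Sum>n<l. s n * z ^ n) + z ^ l * (s l + z * R2 z)"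
      by (simp add: algebra_simps)
    finally have "of_real c * g z + of_real B * (z * deriv g z) =
        (\<Sum>n<l. s n * z ^ n) + z ^ l * (s l + z * R2 z)" .
    then have zg'_eq: "z * deriv g z = - w z * ((\<Sum>n<l. s n * z ^ n) + z ^ l * (s l + z * R2 z))"
      using ode[OF z] by simp
    have "(\<Sum>n<Suc l. of_nat n * a n * z ^ n) + z ^ Suc l * T z =
        z * deriv g z + w z * (z ^ l * (s l + z * R2 z))"
      unfolding zg'[OF z] T_def v(2)[OF z] by (simp add: algebra_simps)
    also have "\<dots> = - w z * (\<Sum>n<l. s n * z ^ n)"
      unfolding zg'_eq by (simp only: distrib_left) simp
    finally show "norm ((\<Sum>n<Suc l. of_nat n * a n * z ^ n) + z ^ Suc l * T z)
        \<le> norm (\<Sum>n<l. s n * z ^ n)"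
      using w(3)[OF z] by (simp add: norm_mult mult_left_le_one_le)
  qed
  then show ?thesis
    by (simp add: s_def norm_mult power_mult_distrib lessThan_Suc_atMost flip: of_real_mult of_real_add)
qed

section \<open>The two regimes of the coefficient recursion\<close>

text \<open>
  The weights \<open>d n = (c + B n)\<^sup>2 - n\<^sup>2\<close> are nonnegative up to \<open>M\<close> and, under the extra
  hypothesis of the second part, nonpositive from \<open>M + 1\<close> on. The product \<open>P\<close> solves
  the recursion with equality, whence the telescoping sum that drives both parts.
\<close>

lemma coefficient_recursion_bounds:
  fixes x P :: "nat \<Rightarrow> real" and c B :: real and M :: nat
  assumes B: "-1 \<le> B" "B \<le> 1" and c: "0 \<le> c"
    and x: "x 0 = 1" "\<And>n. 0 \<le> x n"
    and rec: "\<And>l. (\<Sum>n\<le>l. (real n * x n)\<^sup>2) \<le> (\<Sum>n<l. ((c + B * real n) * x n)\<^sup>2)"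
    and P_def: "\<And>l. P l = (\<Prod>j<l. (c + B * real j) / (real j + 1))"
    and M: "real M * (1 - B) \<le> c"
  shows growth_phase: "l \<le> Suc M \<Longrightarrow> x l \<le> P l"
    and decay_phase: "c \<le> real (Suc M) * (1 - B) \<Longrightarrow> Suc M \<le> l \<Longrightarrow>
           x l \<le> real (Suc M) / real l * P (Suc M)"
proof -
  define d where "d n = (c + B * real n)\<^sup>2 - (real n)\<^sup>2" for n
  have d_factor: "d n = (c - real n * (1 - B)) * (c + real n * (1 + B))" for n
    by (simp add: d_def power2_eq_square algebra_simps)
  have second: "0 \<le> c + real n * (1 + B)" for n
    using B c by simp
  have n_le: "real n \<le> c + B * real n" if "n \<le> M" for n
  proof -
    have "real n * (1 - B) \<le> real M * (1 - B)"
      using that B by (intro mult_right_mono) auto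
    with M show ?thesis by (simp add: algebra_simps)
  qed
  have P_Suc: "real (Suc n) * P (Suc n) = (c + B * real n) * P n" for n
    using of_nat_neq_0[of n, where 'a = real] by (simp add: P_def add.commute)
  have P_nonneg: "0 \<le> P n" if "n \<le> Suc M" for n
    unfolding P_def using that by (intro prod_nonneg divide_nonneg_nonneg ballI)
      (auto intro: order.trans[OF _ n_le])
  have main: "(real l * x l)\<^sup>2 \<le> (\<Sum>n<l. d n * (x n)\<^sup>2)" for l
    using rec[of l] by (simp add: d_def lessThan_Suc_atMost[symmetric] power_mult_distrib
        left_diff_distrib sum_subtractf)
  have telescope: "(\<Sum>n<l. d n * (P n)\<^sup>2) = (real l * P l)\<^sup>2" for l
  proof (induction l)
    case (Suc l)
    have "(real (Suc l) * P (Suc l))\<^sup>2 = ((c + B * real l) * P l)\<^sup>2"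
      using P_Suc[of l] by simp
    with Suc show ?case
      by (simp add: d_def power_mult_distrib left_diff_distrib del: of_nat_Suc)
  qed simp
  show growth: "x l \<le> P l" if "l \<le> Suc M" for l
    using that
  proof (induction l rule: less_induct)
    case (less l)
    show ?case
    proof (cases "l = 0")
      case True
      then show ?thesis by (simp add: x P_def)
    next
      case False
      have "(real l * x l)\<^sup>2 \<le> (\<Sum>n<l. d n * (x n)\<^sup>2)"
        by (rule main)
      also have "\<dots> \<le> (\<Sum>n<l. d n * (P n)\<^sup>2)"
      proof (intro sum_mono mult_left_mono)
        fix n assume "n \<in> {..<l}"
        then have n: "n < l" "n \<le> M" using less.prems by auto
        show "(x n)\<^sup>2 \<le> (P n)\<^sup>2"
          using less.IH[of n] n x by (intro power_mono) auto
        show "0 \<le> d n"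
          unfolding d_def using n_le[OF n(2)] by (simp add: power_mono)
      qed
      also have "\<dots> = (real l * P l)\<^sup>2"
        by (rule telescope)
      finally have "real l * x l \<le> real l * P l"
        by (rule power2_le_imp_le) (intro mult_nonneg_nonneg of_nat_0_le_iff P_nonneg less.prems)
      then show ?thesis using False by simp
    qed
  qed
  show "x l \<le> real (Suc M) / real l * P (Suc M)"
    if top: "c \<le> real (Suc M) * (1 - B)" and l: "Suc M \<le> l"
  proof -
    have "(real l * x l)\<^sup>2 \<le> (\<Sum>n<l. d n * (x n)\<^sup>2)"
      by (rule main)
    also have "\<dots> \<le> (\<Sum>n<Suc M. d n * (x n)\<^sup>2)"
    proof -
      have "d n * (x n)\<^sup>2 \<le> 0" if "n \<notin> {..<Suc M}" for n
      proof -
        have "real (Suc M) * (1 - B) \<le> real n * (1 - B)"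
          using that B by (intro mult_right_mono) auto
        then have "d n \<le> 0"
          unfolding d_factor using top second[of n] by (intro mult_nonpos_nonneg) auto
        then show ?thesis by (simp add: mult_nonpos_nonneg)
      qed
      then have "(\<Sum>n\<in>{..<l} - {..<Suc M}. d n * (x n)\<^sup>2) \<le> 0"
        by (intro sum_nonpos) auto
      moreover have "(\<Sum>n<l. d n * (x n)\<^sup>2) =
          (\<Sum>n\<in>{..<l} - {..<Suc M}. d n * (x n)\<^sup>2) + (\<Sum>n<Suc M. d n * (x n)\<^sup>2)"
        using l by (intro sum.subset_diff) auto
      ultimately show ?thesis by linarith
    qed
    also have "\<dots> \<le> (\<Sum>n<Suc M. d n * (P n)\<^sup>2)"
    proof (intro sum_mono mult_left_mono)
      fix n assume "n \<in> {..<Suc M}"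
      then have n: "n \<le> M" by auto
      show "(x n)\<^sup>2 \<le> (P n)\<^sup>2"
        using growth[of n] n x by (intro power_mono) auto
      show "0 \<le> d n"
        unfolding d_def using n_le[OF n] by (simp add: power_mono)
    qed
    also have "\<dots> = (real (Suc M) * P (Suc M))\<^sup>2"
      by (rule telescope)
    finally have "real l * x l \<le> real (Suc M) * P (Suc M)"
      by (rule power2_le_imp_le) (intro mult_nonneg_nonneg of_nat_0_le_iff P_nonneg order_refl)
    then show ?thesis using l by (simp add: field_simps)
  qed
qed

section \<open>The differential equation of the power\<close>

lemma one_plus_real_mult_ne_0:
  assumes "-1 \<le> B" "B \<le> 1" "norm u < 1"
  shows "1 + complex_of_real B * u \<noteq> 0"
proof
  assume "1 + complex_of_real B * u = 0"
  then have "norm (complex_of_real B * u) = norm (- 1 :: complex)"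
    by (metis add_eq_0_iff)
  moreover have "\<bar>B\<bar> * norm u \<le> 1 * norm u"
    using assms by (intro mult_right_mono) auto
  ultimately show False
    using assms by (simp add: norm_mult)
qed

text \<open>
  Put \<open>k(z) = f(z)/z\<close> and \<open>w = z v\<close>. The subordination gives \<open>k' = u k\<close> with
  \<open>u = (A - B) v / (1 + B w)\<close> where \<open>k\<close> is nonzero, and by analytic continuation everywhere. A
  solution of this equation with \<open>k 0 = 1\<close> is the exponential of a primitive of \<open>u\<close>; hence
  \<open>k\<close> has no zeros, without appeal to univalence, and \<open>log_branch k\<close> is that primitive.
\<close>

lemma power_branch_differential_equation:
  fixes A B \<mu> :: real
  assumes B: "-1 \<le> B" "B \<le> 1"
    and f: "f holomorphic_on ball 0 1" "f 0 = 0" "deriv f 0 = 1"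
    and w: "w holomorphic_on ball 0 1" "w 0 = 0" "\<And>z. norm z < 1 \<Longrightarrow> norm (w z) < 1"
    and q: "\<And>z. norm z < 1 \<Longrightarrow> starlike_quotient f z =
              (1 + complex_of_real A * w z) / (1 + complex_of_real B * w z)"
  shows "power_branch (quotient_by_id f) \<mu> holomorphic_on ball 0 1"
    and "power_branch (quotient_by_id f) \<mu> 0 = 1"
    and "\<And>z. norm z < 1 \<Longrightarrow>
           z * deriv (power_branch (quotient_by_id f) \<mu>) z * (1 + complex_of_real B * w z) =
           complex_of_real (\<mu> * (A - B)) * w z * power_branch (quotient_by_id f) \<mu> z"
proof -
  define k where "k = quotient_by_id f"
  have den: "1 + complex_of_real B * w z \<noteq> 0" if "norm z < 1" for z
    using one_plus_real_mult_ne_0[OF B w(3)[OF that]] .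
  obtain v where v: "v holomorphic_on ball 0 1" "\<And>z. norm z < 1 \<Longrightarrow> w z = z * v z"
    using Schwarz3[OF w(1,2)] by blast
  obtain k' where k': "k' holomorphic_on ball 0 1" "\<And>z. norm z < 1 \<Longrightarrow> f z = z * k' z"
    "deriv f 0 = k' 0"
    using Schwarz3[OF f(1,2)] by blast
  have k'_eq: "k' z = k z" if "norm z < 1" for z
    using k'(2)[OF that] k'(3) by (simp add: k_def quotient_by_id_def)
  have k: "k holomorphic_on ball 0 1"
    by (rule holomorphic_transform[OF k'(1)]) (simp add: k'_eq)
  have k_der: "(k has_field_derivative deriv k z) (at z)" if "norm z < 1" for z
    using holomorphic_derivI[OF k open_ball] that by simp
  have k0: "k 0 = 1"
    by (simp add: k_def quotient_by_id_def f)
  have f_eq: "f z = z * k z" if "norm z < 1" for z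
    using k'(2)[OF that] k'_eq[OF that] by simp
  have f_deriv: "deriv f z = k z + z * deriv k z" if z: "norm z < 1" for z
  proof -
    have "((\<lambda>z. z * k z) has_field_derivative k z + z * deriv k z) (at z)"
      by (rule derivative_eq_intros k_der[OF z] refl)+ simp
    then have "(f has_field_derivative k z + z * deriv k z) (at z)"
      by (rule has_field_derivative_transform_within_open[of _ _ _ "ball 0 1"])
         (use z f_eq in auto)
    then show ?thesis by (rule DERIV_imp_deriv)
  qed
  have k_ode: "deriv k z * (1 + complex_of_real B * w z) = complex_of_real (A - B) * v z * k z"
    if "norm z < 1" for z
  proof (rule analytic_continuation_open[where f =
        "\<lambda>z. deriv k z * (1 + complex_of_real B * w z)" and g =
        "\<lambda>z. complex_of_real (A - B) * v z * k z"])
    \<comment> \<open>Where \<open>z\<close> or \<open>k z\<close> vanishes, \<open>starlike_quotient f z\<close> is a default value.\<close>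
    define U where "U = {z \<in> ball 0 1. k z \<noteq> 0}"
    have "U = ball 0 1 \<inter> k -` (- {0})"
      by (auto simp: U_def)
    then have U: "open U"
      using continuous_open_preimage[OF holomorphic_on_imp_continuous_on[OF k] open_ball, of "- {0}"]
      by (simp add: open_Compl)
    then show "open (U - {0})"
      by (rule open_delete)
    have "0 \<in> U"
      by (simp add: U_def k0)
    then have "U = {0}" if "U - {0} = {}"
      using that by blast
    then show "U - {0} \<noteq> {}"
      using U not_open_singleton[of "0::complex"] by blast
    show "U - {0} \<subseteq> ball 0 1"
      by (auto simp: U_def)
    fix z assume "z \<in> U - {0}"
    then have z: "norm z < 1" "z \<noteq> 0" "k z \<noteq> 0" by (auto simp: U_def)
    have "(k z + z * deriv k z) / k z =
        (1 + complex_of_real A * w z) / (1 + complex_of_real B * w z)"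
      using q[OF z(1)] z by (simp add: starlike_quotient_def f_eq f_deriv)
    then have "(k z + z * deriv k z) * (1 + complex_of_real B * w z) =
        (1 + complex_of_real A * w z) * k z"
      using den[OF z(1)] z by (simp add: frac_eq_eq)
    then have "z * (deriv k z * (1 + complex_of_real B * w z)) =
        complex_of_real (A - B) * w z * k z"
      by (simp add: algebra_simps)
    also have "\<dots> = z * (complex_of_real (A - B) * v z * k z)"
      by (simp add: v(2)[OF z(1)])
    finally show "deriv k z * (1 + complex_of_real B * w z) = complex_of_real (A - B) * v z * k z"
      using z(2) by simp
  qed (use that in \<open>auto intro!: holomorphic_intros k v w\<close>)
  define u where "u z = complex_of_real (A - B) * v z / (1 + complex_of_real B * w z)" for z
  have u: "u holomorphic_on ball 0 1"
    unfolding u_def by (intro holomorphic_intros v w) (use den in auto)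
  have k_deriv: "deriv k z = u z * k z" if "norm z < 1" for z
    using k_ode[OF that] den[OF that] by (simp add: u_def field_simps)
  have "\<exists>L. L holomorphic_on ball 0 1 \<and> L 0 = 0 \<and> (\<forall>z\<in>ball 0 1. exp (L z) = k z)"
  proof -
    obtain L where "\<And>z. z \<in> ball 0 1 \<Longrightarrow> (L has_field_derivative u z) (at z within ball 0 1)"
      using holomorphic_convex_primitive'[OF convex_ball open_ball u] by blast
    then have L: "(L has_field_derivative u z) (at z)" if "z \<in> ball 0 1" for z
      using that at_within_open[OF that open_ball] by metis
    \<comment> \<open>The quotient of \<open>k\<close> and the candidate \<open>exp (L z - L 0)\<close> is constant.\<close>
    have "((\<lambda>z. k z * exp (L 0 - L z)) has_field_derivative 0) (at z within ball 0 1)"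
      if z: "z \<in> ball 0 1" for z
    proof (rule has_field_derivative_at_within)
      show "((\<lambda>z. k z * exp (L 0 - L z)) has_field_derivative 0) (at z)"
        using z by (auto intro!: derivative_eq_intros k_der L simp: k_deriv)
    qed
    from has_field_derivative_zero_constant[OF convex_ball this]
    obtain C where C: "\<And>z. z \<in> ball 0 1 \<Longrightarrow> k z * exp (L 0 - L z) = C"
      by blast
    have "C = 1"
      using C[of 0] by (simp add: k0)
    then have "exp (L z - L 0) = k z" if "z \<in> ball 0 1" for z
      using C[OF that] by (simp add: exp_diff field_simps)
    moreover have "(\<lambda>z. L z - L 0) holomorphic_on ball 0 1"
      by (rule holomorphic_onI, rule field_differentiable_at_within)
         (auto simp: field_differentiable_def intro!: derivative_eq_intros exI L)
    ultimately show ?thesis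
      by (intro exI[of _ "\<lambda>z. L z - L 0"]) simp
  qed
  from someI_ex[OF this]
  have L: "log_branch k holomorphic_on ball 0 1" "log_branch k 0 = 0"
    "\<And>z. norm z < 1 \<Longrightarrow> exp (log_branch k z) = k z"
    by (auto simp: log_branch_def)
  have L_der: "(log_branch k has_field_derivative u z) (at z)" if z: "norm z < 1" for z
  proof -
    let ?L = "log_branch k"
    have d: "(?L has_field_derivative deriv ?L z) (at z)"
      using holomorphic_derivI[OF L(1) open_ball] z by simp
    then have "((\<lambda>z. exp (?L z)) has_field_derivative exp (?L z) * deriv ?L z) (at z)"
      by (auto intro!: derivative_eq_intros)
    then have "(k has_field_derivative exp (?L z) * deriv ?L z) (at z)"
      by (rule has_field_derivative_transform_within_open[of _ _ _ "ball 0 1"])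
         (use z L in auto)
    then have "exp (?L z) * deriv ?L z = u z * exp (?L z)"
      using DERIV_unique[OF k_der[OF z]] k_deriv[OF z] L(3)[OF z] by metis
    then have "deriv ?L z = u z"
      by simp
    with d show ?thesis by simp
  qed
  let ?g = "power_branch k \<mu>"
  show "power_branch (quotient_by_id f) \<mu> holomorphic_on ball 0 1"
    unfolding power_branch_def k_def[symmetric] by (intro holomorphic_intros L)
  show "power_branch (quotient_by_id f) \<mu> 0 = 1"
    unfolding power_branch_def k_def[symmetric] by (simp add: L)
  fix z :: complex assume z: "norm z < 1"
  have "(?g has_field_derivative of_real \<mu> * u z * ?g z) (at z)"
    unfolding power_branch_def[abs_def] by (auto intro!: derivative_eq_intros L_der z)
  then have "z * deriv ?g z * (1 + complex_of_real B * w z) =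
      z * (of_real \<mu> * u z * ?g z) * (1 + complex_of_real B * w z)"
    by (simp add: DERIV_imp_deriv)
  also have "\<dots> = complex_of_real (\<mu> * (A - B)) * w z * ?g z"
    using den[OF z] by (simp add: u_def v(2)[OF z])
  finally show "z * deriv (power_branch (quotient_by_id f) \<mu>) z * (1 + complex_of_real B * w z) =
      complex_of_real (\<mu> * (A - B)) * w z * power_branch (quotient_by_id f) \<mu> z"
    by (simp only: k_def)
qed

section \<open>Extremal functions\<close>

text \<open>
  The Schwarz function \<open>w(z) = z\<^sup>k\<close> is realized by \<open>f(z) = z exp (Q(z) - Q(0))\<close> with
  \<open>Q' = (A - B) z\<^sup>k\<^sup>-\<^sup>1 / (1 + B z\<^sup>k)\<close>. The primitive is left implicit because its closed form
  differs between \<open>B = 0\<close> and \<open>B \<noteq> 0\<close>. For this \<open>w\<close> the differential equation is a two-term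
  recursion.
\<close>

lemma extremal_function:
  fixes A B \<mu> :: real and k :: nat
  assumes B: "-1 \<le> B" "B \<le> 1" and k: "k \<ge> 1"
  obtains f where "f \<in> janowski_starlike A B"
    and "power_coeff \<mu> f 0 = 1"
    and "\<And>n. of_nat n * power_coeff \<mu> f n =
           (if n < k then 0
            else of_real (\<mu> * (A - B) - B * real (n - k)) * power_coeff \<mu> f (n - k))"
proof -
  have pow_lt: "norm (z ^ k) < 1" if "norm z < 1" for z :: complex
    using that k by (simp add: norm_power power_less_one_iff)
  have den: "1 + complex_of_real B * z ^ k \<noteq> 0" if "norm z < 1" for z
    by (rule one_plus_real_mult_ne_0[OF B pow_lt[OF that]])
  define u where "u z = complex_of_real (A - B) * z ^ (k - 1) / (1 + complex_of_real B * z ^ k)" for z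
  have "u holomorphic_on ball 0 1"
    unfolding u_def by (intro holomorphic_intros) (use den in auto)
  then obtain Q where "\<And>z. z \<in> ball 0 1 \<Longrightarrow> (Q has_field_derivative u z) (at z within ball 0 1)"
    using holomorphic_convex_primitive'[OF convex_ball open_ball] by blast
  then have Q: "(Q has_field_derivative u z) (at z)" if "norm z < 1" for z
    using that at_within_open[of z "ball 0 1"] by (metis open_ball mem_ball_0)
  define f where "f z = z * exp (Q z - Q 0)" for z
  have f_der: "(f has_field_derivative (1 + z * u z) * exp (Q z - Q 0)) (at z)"
    if "norm z < 1" for z
    unfolding f_def[abs_def] by (rule derivative_eq_intros Q[OF that] refl)+ (simp add: algebra_simps)
  have f: "f holomorphic_on ball 0 1" "f 0 = 0" "deriv f 0 = 1"
  proof -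
    show "f holomorphic_on ball 0 1"
      by (rule holomorphic_onI, rule field_differentiable_at_within)
         (use f_der in \<open>auto simp: field_differentiable_def\<close>)
    show "f 0 = 0" by (simp add: f_def)
    show "deriv f 0 = 1"
      using DERIV_imp_deriv[OF f_der[of 0]] by simp
  qed
  have q: "starlike_quotient f z =
      (1 + complex_of_real A * z ^ k) / (1 + complex_of_real B * z ^ k)" if z: "norm z < 1" for z
  proof (cases "z = 0")
    case True
    then show ?thesis using k by (simp add: starlike_quotient_def power_0_left)
  next
    case False
    have "starlike_quotient f z = 1 + z * u z"
      using False DERIV_imp_deriv[OF f_der[OF z]] by (simp add: starlike_quotient_def f_def)
    also have "z * u z = complex_of_real (A - B) * z ^ k / (1 + complex_of_real B * z ^ k)"
      using k by (simp add: u_def power_eq_if)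
    also have "1 + \<dots> = (1 + complex_of_real A * z ^ k) / (1 + complex_of_real B * z ^ k)"
      using den[OF z] by (simp add: field_simps)
    finally show ?thesis .
  qed
  have zk: "(\<lambda>z. z ^ k) holomorphic_on ball 0 1" "(0::complex) ^ k = 0"
    using k by (auto intro!: holomorphic_intros)
  have "starlike_quotient f holomorphic_on ball 0 1"
  proof (rule holomorphic_transform)
    show "(\<lambda>z. (1 + complex_of_real A * z ^ k) / (1 + complex_of_real B * z ^ k)) holomorphic_on ball 0 1"
      by (intro holomorphic_intros) (use den in auto)
  qed (simp add: q)
  moreover have "(\<lambda>z. (1 + complex_of_real A * z) / (1 + complex_of_real B * z)) holomorphic_on ball 0 1"
    by (intro holomorphic_intros) (use one_plus_real_mult_ne_0[OF B] in auto)
  ultimately have "f \<in> janowski_starlike A B"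
    unfolding janowski_starlike_def subordinate_def mem_Collect_eq
    using f zk pow_lt q by (intro conjI exI[of _ "\<lambda>z. z ^ k"] ballI) auto
  define g where "g = power_branch (quotient_by_id f) \<mu>"
  have g: "g holomorphic_on ball 0 1" "g 0 = 1"
    "\<And>z. norm z < 1 \<Longrightarrow> z * deriv g z * (1 + complex_of_real B * z ^ k) =
       complex_of_real (\<mu> * (A - B)) * z ^ k * g z"
    using power_branch_differential_equation[OF B f zk pow_lt q, where \<mu> = \<mu>] unfolding g_def by auto
  define G where "G = fps_expansion g 0"
  have G: "g has_fps_expansion G"
    unfolding G_def by (rule has_fps_expansion_fps_expansion[OF open_ball _ g(1)]) simp
  have coeff: "power_coeff \<mu> f n = fps_nth G n" for n
    by (simp add: power_coeff_def G_def g_def)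
  have "(\<lambda>z. z * deriv g z * (1 + complex_of_real B * z ^ k)) has_fps_expansion
      fps_X * fps_deriv G * (1 + fps_const (of_real B) * fps_X ^ k)"
    by (intro fps_expansion_intros G)
  moreover have "(\<lambda>z. z * deriv g z * (1 + complex_of_real B * z ^ k)) has_fps_expansion
      fps_const (of_real (\<mu> * (A - B))) * fps_X ^ k * G"
  proof -
    have "eventually (\<lambda>z::complex. z \<in> ball 0 1) (nhds 0)"
      by (rule eventually_nhds_in_open) auto
    then have "eventually (\<lambda>z. z * deriv g z * (1 + complex_of_real B * z ^ k) =
        complex_of_real (\<mu> * (A - B)) * z ^ k * g z) (nhds 0)"
      by eventually_elim (use g in auto)
    from has_fps_expansion_cong[OF this refl] show ?thesis
      by (auto intro!: fps_expansion_intros G)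
  qed
  ultimately have G_eq: "fps_X * fps_deriv G + fps_const (of_real B) * (fps_X ^ k * (fps_X * fps_deriv G)) =
      fps_const (of_real (\<mu> * (A - B))) * (fps_X ^ k * G)"
    by (metis (no_types, lifting) fps_expansion_unique_complex distrib_left mult.assoc mult.commute mult_1_right)
  have XG: "fps_nth (fps_X * fps_deriv G) n = of_nat n * fps_nth G n" for n
    by (cases n) simp_all
  have rec: "of_nat n * fps_nth G n = (if n < k then 0
      else of_real (\<mu> * (A - B) - B * real (n - k)) * fps_nth G (n - k))" for n
  proof -
    have "of_nat n * fps_nth G n +
        of_real B * (if n < k then 0 else of_nat (n - k) * fps_nth G (n - k)) =
        of_real (\<mu> * (A - B)) * (if n < k then 0 else fps_nth G (n - k))"
      using arg_cong[OF G_eq, of "\<lambda>F. fps_nth F n"]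
      by (simp only: fps_add_nth fps_mult_left_const_nth fps_X_power_mult_nth XG)
    then show ?thesis
      by (cases "n < k") (simp_all add: algebra_simps)
  qed
  show thesis
  proof (rule that)
    show "power_coeff \<mu> f 0 = 1"
      using g(2) by (simp add: coeff G_def fps_expansion_def)
  qed (use rec \<open>f \<in> _\<close> in \<open>simp_all add: coeff\<close>)
qed

section \<open>Estimates for the class and their sharpness\<close>

lemma power_coeff_square_sums:
  fixes A B lam :: real
  assumes B: "-1 \<le> B" "B \<le> 1" and f: "f \<in> janowski_starlike A B"
  shows "norm (power_coeff (-lam) f 0) = 1"
    and "(\<Sum>n\<le>l. (real n * norm (power_coeff (-lam) f n))\<^sup>2) \<le>
         (\<Sum>n<l. ((lam * (A - B) + B * real n) * norm (power_coeff (-lam) f n))\<^sup>2)"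
proof -
  obtain w where w: "w holomorphic_on ball 0 1" "w 0 = 0" "\<And>z. norm z < 1 \<Longrightarrow> norm (w z) < 1"
    and q: "\<And>z. norm z < 1 \<Longrightarrow> starlike_quotient f z =
              (1 + complex_of_real A * w z) / (1 + complex_of_real B * w z)"
    and f': "f holomorphic_on ball 0 1" "f 0 = 0" "deriv f 0 = 1"
    using f unfolding janowski_starlike_def subordinate_def by auto
  define g where "g = power_branch (quotient_by_id f) (-lam)"
  have g: "g holomorphic_on ball 0 1" "g 0 = 1"
    "\<And>z. norm z < 1 \<Longrightarrow> z * deriv g z * (1 + complex_of_real B * w z) =
       complex_of_real (- lam * (A - B)) * w z * g z"
    using power_branch_differential_equation[OF B f' w q, where \<mu> = "-lam"] unfolding g_def by auto
  have coeff: "power_coeff (-lam) f = fps_nth (fps_expansion g 0)"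
    by (rule ext) (simp add: power_coeff_def g_def)
  show "norm (power_coeff (-lam) f 0) = 1"
    using g(2) by (simp add: coeff fps_expansion_def)
  have ode: "z * deriv g z = - w z * (of_real (lam * (A - B)) * g z + of_real B * (z * deriv g z))"
    if "norm z < 1" for z
    using g(3)[OF that] by (simp add: algebra_simps add_eq_0_iff)
  show "(\<Sum>n\<le>l. (real n * norm (power_coeff (-lam) f n))\<^sup>2) \<le>
         (\<Sum>n<l. ((lam * (A - B) + B * real n) * norm (power_coeff (-lam) f n))\<^sup>2)"
    unfolding coeff by (rule clunie_inequality[OF g(1) w ode])
qed

lemma coeff_estimate_growth:
  fixes A B lam :: real
  assumes "-1 \<le> B" "B < A" "A \<le> 1" "lam > 0"
    and "real M * (1 - B) \<le> lam * (A - B)" and "l \<le> Suc M"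
  shows "coeff_estimate A B lam l (coeff_prod A B lam l)"
  unfolding coeff_estimate_def
proof
  fix f assume "f \<in> janowski_starlike A B"
  note sq = power_coeff_square_sums[OF _ _ this, of lam]
  show "norm (power_coeff (-lam) f l) \<le> coeff_prod A B lam l"
    by (rule growth_phase[where c = "lam * (A - B)" and B = B and M = M])
       (use assms sq in \<open>auto simp: coeff_prod_def\<close>)
qed

lemma coeff_estimate_decay:
  fixes A B lam :: real
  assumes "-1 \<le> B" "B < A" "A \<le> 1" "lam > 0"
    and "real M * (1 - B) \<le> lam * (A - B)" "lam * (A - B) \<le> real (Suc M) * (1 - B)" "Suc M \<le> l"
  shows "coeff_estimate A B lam l (real (Suc M) / real l * coeff_prod A B lam (Suc M))"
  unfolding coeff_estimate_def
proof
  fix f assume "f \<in> janowski_starlike A B"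
  note sq = power_coeff_square_sums[OF _ _ this, of lam]
  show "norm (power_coeff (-lam) f l) \<le> real (Suc M) / real l * coeff_prod A B lam (Suc M)"
    by (rule decay_phase[where c = "lam * (A - B)" and B = B])
       (use assms sq in \<open>auto simp: coeff_prod_def simp del: of_nat_Suc\<close>)
qed

text \<open>
  For \<open>w(z) = z\<close> the recursion is \<open>(n + 1) a\<^sub>n\<^sub>+\<^sub>1 = - (c + B n) a\<^sub>n\<close>. The factors \<open>c + B n\<close> are
  nonnegative for \<open>n \<le> M\<close>, so the moduli are exactly the products.
\<close>

lemma sharp_coeff_estimate_growth:
  fixes A B lam :: real
  assumes AB: "-1 \<le> B" "B < A" "A \<le> 1" "lam > 0"
    and M: "real M * (1 - B) \<le> lam * (A - B)" and l: "l \<le> Suc M"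
  shows "sharp_coeff_estimate A B lam l (coeff_prod A B lam l)"
proof -
  obtain f where f: "f \<in> janowski_starlike A B" "power_coeff (-lam) f 0 = 1"
    and rec: "\<And>n. of_nat n * power_coeff (-lam) f n = (if n < 1 then 0
        else of_real (- lam * (A - B) - B * real (n - 1)) * power_coeff (-lam) f (n - 1))"
    using extremal_function[of B 1 A "-lam"] AB by auto
  have "norm (power_coeff (-lam) f l) = coeff_prod A B lam l"
    using l
  proof (induction l)
    case 0
    then show ?case by (simp add: f coeff_prod_def)
  next
    case (Suc n)
    have "real n * (1 - B) \<le> real M * (1 - B)"
      using Suc.prems AB by (intro mult_right_mono) auto
    then have nonneg: "0 \<le> lam * (A - B) + B * real n"
      using M by (simp add: algebra_simps)
    have "real (Suc n) * norm (power_coeff (-lam) f (Suc n)) =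
        norm (of_nat (Suc n) * power_coeff (-lam) f (Suc n))"
      by (simp only: norm_mult norm_of_nat)
    also have "\<dots> = \<bar>- lam * (A - B) - B * real n\<bar> * norm (power_coeff (-lam) f n)"
      unfolding rec by (simp add: norm_mult del: of_real_diff of_real_mult of_real_minus)
    also have "\<bar>- lam * (A - B) - B * real n\<bar> = lam * (A - B) + B * real n"
      using nonneg by linarith
    also have "norm (power_coeff (-lam) f n) = coeff_prod A B lam n"
      using Suc by simp
    finally show ?case
      by (simp add: coeff_prod_def field_simps)
  qed
  with f show ?thesis
    using coeff_estimate_growth[OF AB M l] unfolding sharp_coeff_estimate_def by blast
qed

text \<open>
  When already the weight of \<open>n = 1\<close> is nonpositive, only \<open>a\<^sub>0 = 1\<close> survives in the recursion. The
  bound \<open>c / l\<close> is attained by \<open>w(z) = z\<^sup>l\<close>, whose first nonconstant coefficient is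
  \<open>a\<^sub>l = - c / l\<close>; the extremal function depends on \<open>l\<close>.
\<close>

lemma sharp_coeff_estimate_pure_decay:
  fixes A B lam :: real
  assumes AB: "-1 \<le> B" "B < A" "A \<le> 1" "lam > 0"
    and small: "lam * (A - B) \<le> 1 - B" and l: "l \<ge> 1"
  shows "sharp_coeff_estimate A B lam l (lam * (A - B) / real l)"
proof -
  obtain f where f: "f \<in> janowski_starlike A B" "power_coeff (-lam) f 0 = 1"
    and rec: "of_nat l * power_coeff (-lam) f l =
        of_real (- lam * (A - B) - B * real (l - l)) * power_coeff (-lam) f (l - l)"
    using extremal_function[of B l A "-lam"] AB l by (metis less_irrefl less_imp_le order_trans)
  have "real l * norm (power_coeff (-lam) f l) = norm (of_nat l * power_coeff (-lam) f l)"
    by (simp only: norm_mult norm_of_nat)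
  also have "\<dots> = lam * (A - B)"
    unfolding rec using AB f by (simp add: norm_mult flip: of_real_diff)
  finally have "norm (power_coeff (-lam) f l) = lam * (A - B) / real l"
    using l by (simp add: field_simps)
  moreover have "coeff_estimate A B lam l (lam * (A - B) / real l)"
    using coeff_estimate_decay[OF AB, of 0 l] AB small l by (simp add: coeff_prod_def)
  ultimately show ?thesis
    using f unfolding sharp_coeff_estimate_def by blast
qed

theorem theorem2p7:
  fixes A B lam \<delta> :: real and N :: nat
  assumes "-1 \<le> B" and "B < A" and "A \<le> 1" and "lam > 0"
    and "\<delta> = (1 - A) / (1 - B)"
    and "N = nat \<lfloor>lam\<rfloor>"
  shows "0 \<le> \<delta> \<and> \<delta> < 1 \<and>
    (lam \<le> 1 \<longrightarrow>
       (\<forall>l\<ge>1. sharp_coeff_estimate A B lam l (lam * (A - B) / real l))) \<and>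
    (lam > 1 \<longrightarrow>
       (\<forall>k<N. \<delta> \<in> I_set k lam \<longrightarrow>
          (lam * (1 - \<delta>) \<notin> \<nat> \<longrightarrow>
             (\<forall>l\<in>{1..N - k}. sharp_coeff_estimate A B lam l (coeff_prod A B lam l)) \<and>
             (\<forall>l\<ge>N - k + 1. coeff_estimate A B lam l
                (real (N - k) / real l * coeff_prod A B lam (N - k)))) \<and>
          (lam * (1 - \<delta>) \<in> \<nat> \<longrightarrow>
             (\<forall>l\<in>{1..N - k + 1}. sharp_coeff_estimate A B lam l (coeff_prod A B lam l)) \<and>
             (\<forall>l\<ge>N - k + 2. coeff_estimate A B lam l
                (real (N - k) / real l * coeff_prod A B lam (N - k))))) \<and>
       (\<delta> \<in> I_set (N - 1) lam \<longrightarrow>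
          (\<forall>l\<ge>1. sharp_coeff_estimate A B lam l (lam * (A - B) / real l))) \<and>
       (\<delta> \<in> J_set lam \<longrightarrow>
          (\<forall>l\<in>{1..N + 1}. sharp_coeff_estimate A B lam l (coeff_prod A B lam l)) \<and>
          (\<forall>l\<ge>N + 2. coeff_estimate A B lam l
             (real (N + 1) / real l * coeff_prod A B lam (N + 1)))))"
proof -
  define t where "t = lam * (1 - \<delta>)"
  have B1: "0 < 1 - B"
    using assms by linarith
  have \<delta>: "0 \<le> \<delta>" "\<delta> < 1"
    using assms(1-4) B1 unfolding assms(5) by auto
  have c_eq: "lam * (A - B) = t * (1 - B)"
  proof -
    have "1 - \<delta> = (A - B) / (1 - B)"
      using B1 assms(5) by (simp add: field_simps)
    then show ?thesis using B1 by (simp add: t_def)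
  qed
  \<comment> \<open>\<open>t\<close> is the index at which the weights of the recursion change sign.\<close>
  have le_c: "real M * (1 - B) \<le> lam * (A - B)" if "real M \<le> t" for M
    using that B1 unfolding c_eq by (intro mult_right_mono) auto
  have c_le: "lam * (A - B) \<le> real M * (1 - B)" if "t \<le> real M" for M
    using that B1 unfolding c_eq by (intro mult_right_mono) auto
  have t_pos: "0 < t"
    using \<delta> assms(4) by (simp add: t_def)
  note growth = sharp_coeff_estimate_growth[OF assms(1-4) le_c]
  have decay: "coeff_estimate A B lam l (real m / real l * coeff_prod A B lam m)"
    if "1 \<le> m" "real m - 1 \<le> t" "t \<le> real m" "m \<le> l" for m l
    using coeff_estimate_decay[OF assms(1-4) le_c c_le, of "m - 1" l] that by (simp add: of_nat_diff)
  have pure_decay: "sharp_coeff_estimate A B lam l (lam * (A - B) / real l)"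
    if "t \<le> 1" "1 \<le> l" for l
    using sharp_coeff_estimate_pure_decay[OF assms(1-4) _ that(2)] c_le[of 1] that by simp
  have floor: "real_of_int \<lfloor>lam\<rfloor> = real N"
    using assms(4,6) by simp
  have N: "real N \<le> lam" "lam < real N + 1"
    using floor by linarith+
  have I: "real (N - k) - 1 < t \<and> t \<le> real (N - k)" if "k < N" "\<delta> \<in> I_set k lam" for k
  proof -
    have "lam - real N + real k \<le> \<delta> * lam" "\<delta> * lam < lam - real N + real k + 1"
      using that(2) assms(4) by (simp_all add: I_set_def floor field_simps)
    then show ?thesis
      using that(1) by (simp add: t_def algebra_simps of_nat_diff)
  qed
  have J: "real N < t" if "\<delta> \<in> J_set lam"
    using that assms(4) by (simp add: J_set_def floor t_def field_simps)
  have t_le: "t \<le> lam"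
    using \<delta> assms(4) by (simp add: t_def algebra_simps)
  show ?thesis
    unfolding t_def[symmetric]
  proof (intro conjI impI allI ballI \<delta>)
    show "sharp_coeff_estimate A B lam l (lam * (A - B) / real l)" if "lam \<le> 1" "1 \<le> l" for l
      using that t_le by (intro pure_decay) auto
  next
    fix k l assume k: "k < N" "\<delta> \<in> I_set k lam" and l: "l \<in> {1..N - k}"
    show "sharp_coeff_estimate A B lam l (coeff_prod A B lam l)"
      by (rule growth[of "N - k - 1"]) (use I[OF k] k l in \<open>auto simp: of_nat_diff\<close>)
  next
    fix k l assume k: "k < N" "\<delta> \<in> I_set k lam" and l: "N - k + 1 \<le> l"
    show "coeff_estimate A B lam l (real (N - k) / real l * coeff_prod A B lam (N - k))"
      by (rule decay) (use I[OF k] k l in auto)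
  next
    fix k l assume k: "k < N" "\<delta> \<in> I_set k lam" and t: "t \<in> \<nat>" and l: "l \<in> {1..N - k + 1}"
    obtain m where m: "t = real m"
      using t by (auto simp: Nats_def)
    have "t = real (N - k)"
    proof -
      have "real (N - k) < real (m + 1)" "real m \<le> real (N - k)"
        using I[OF k] unfolding m by auto
      then show ?thesis
        unfolding m of_nat_less_iff of_nat_le_iff by simp
    qed
    then show "sharp_coeff_estimate A B lam l (coeff_prod A B lam l)"
      using l by (intro growth[of "N - k"]) auto
  next
    fix k l assume k: "k < N" "\<delta> \<in> I_set k lam" and l: "N - k + 2 \<le> l"
    \<comment> \<open>The term \<open>n = t = N - k\<close> is counted among the nonpositive ones, hence the prefactor
        \<open>N - k\<close> although the product bound holds up to index \<open>N - k + 1\<close>.\<close>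
    show "coeff_estimate A B lam l (real (N - k) / real l * coeff_prod A B lam (N - k))"
      by (rule decay) (use I[OF k] k l in auto)
  next
    fix l :: nat assume "1 < lam" "\<delta> \<in> I_set (N - 1) lam" "1 \<le> l"
    moreover have "0 < N"
      using \<open>1 < lam\<close> N by linarith
    ultimately show "sharp_coeff_estimate A B lam l (lam * (A - B) / real l)"
      using I[of "N - 1"] by (intro pure_decay) auto
  next
    fix l assume "\<delta> \<in> J_set lam" "l \<in> {1..N + 1}"
    then show "sharp_coeff_estimate A B lam l (coeff_prod A B lam l)"
      using J by (intro growth[of N]) auto
  next
    fix l assume "\<delta> \<in> J_set lam" "N + 2 \<le> l"
    then show "coeff_estimate A B lam l (real (N + 1) / real l * coeff_prod A B lam (N + 1))"
      using J t_le N by (intro decay) auto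
  qed
qed

end
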